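(* Fix $k\ge1$. For $M\ge k$ let $X_{i^*}$ be the $k$-th largest among $X_1,\dots,X_M$ (SNR-based selection, SBS), let $F$ be the common CDF of the $X_i$, and set $$\eta=\eta^{\rm SBS}=F^{-1}\left(1-\tfrac1M\right),\qquad \xi=\xi^{\rm SBS}=F^{-1}\left(1-\tfrac1{eM}\right)-\eta^{\rm SBS}.$$ Then, as $M\to\infty$, the outage probability $\Pi^{(k)}_{\rm SBS}(x)=\mathbb P\{X_{i^*}\le x\}$ is asymptotically given by $$\exp\left(-\exp\left(-\frac{x-\eta^{\rm SBS}}{\xi^{\rm SBS}}\right)\right)\sum_{j=0}^{k-1}\frac1{j!}\exp\left(-j\,\frac{x-\eta^{\rm SBS}}{\xi^{\rm SBS}}\right),$$ in the sense that for every real $u$, $$\lim_{M\to\infty}\mathbb P\left\{\frac{X_{i^*}-\eta^{\rm SBS}}{\xi^{\rm SBS}}\le u\right\}=\exp(-\exp(-u))\sum_{j=0}^{k-1}\frac{\exp(-ju)}{j!}.$$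
   Context: There are $M$ devices. The channel gains $|g_i|^2,|h_i|^2$ ($i\ge1$) are independent exponential random variables with mean $1$. Parameters (independent of $M$): $P_t>0$, $\sigma_n^2>0$, $0<t_1<1$, $t_2=1-t_1$, and real constants $a,b,c$ with $c>0$ and $ac-b>0$. The energy harvested by device $i$ is $E_i=t_1\left(\frac{aP_t|g_i|^2+b}{P_t|g_i|^2+c}-\frac bc\right)$, and the SNR of device $i$ is $X_i=\frac{|h_i|^2}{t_2\sigma_n^2}E_i$. The CDF of $X_i$ is, for $x>0$, $$F(x)=1-2\sqrt{\frac{\sigma_n^2c^2t_2x}{P_tt_1(ac-b)}}\;\exp\left(-\frac{\sigma_n^2ct_2x}{t_1(ac-b)}\right)K_1\left(2\sqrt{\frac{\sigma_n^2c^2t_2x}{P_tt_1(ac-b)}}\right),$$ with $K_1$ the modified Bessel function of the second kind of order one; $F$ is continuous and strictly increasing on $[0,\infty)$ with $F(0)=0$. *)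

theory Defs
  imports "HOL-Probability.Probability"
begin

text \<open>
  The \<open>k\<close>-th largest (for \<open>1 \<le> k \<le> n\<close>) among \<open>x 1, \<dots>, x n\<close>, counted with multiplicity.
  For \<open>k\<close> outside this range the value is meaningless.
\<close>

definition kth_largest :: "nat \<Rightarrow> nat \<Rightarrow> (nat \<Rightarrow> 'a::linorder) \<Rightarrow> 'a" where
  "kth_largest k n x = rev (sort (map x [1..<Suc n])) ! (k - 1)"

end

theory Submission
  imports Defs
begin

text \<open>
  With \<open>\<gamma> = c / P\<^sub>t\<close> and \<open>\<kappa> = t\<^sub>1 (a c - b) / (c t\<^sub>2 \<sigma>\<^sub>n\<^sup>2)\<close> one has
  \<open>X = \<kappa> |h|\<^sup>2 |g|\<^sup>2 / (|g|\<^sup>2 + \<gamma>)\<close>, so conditioning on \<open>|g|\<^sup>2\<close> gives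
  \<open>P (X > \<kappa> s) = exp (- s) E (exp (- s W))\<close> with \<open>W = \<gamma> / |g|\<^sup>2\<close>. Since \<open>W\<close> takes arbitrarily
  small values, the ratio of its Laplace transform at \<open>s + v\<close> and at \<open>s\<close> tends to 1. Hence
  the tail \<open>T\<close> of \<open>X\<close> satisfies \<open>T (x + \<kappa> v) / T x \<longlongrightarrow> exp (- v)\<close>; this forces
  \<open>\<xi> \<longlonglongrightarrow> \<kappa>\<close> and \<open>M T (\<eta> + \<xi> u) \<longlonglongrightarrow> exp (- u)\<close>. The \<open>k\<close>-th largest value is at most
  \<open>\<eta> + \<xi> u\<close> iff fewer than \<open>k\<close> of the \<open>X\<^sub>i\<close> exceed it, and this binomial count is
  asymptotically Poisson with mean \<open>exp (- u)\<close>.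
\<close>

section \<open>Order statistics as exceedance counts\<close>

text \<open>In an increasing list the entries above \<open>y\<close> form a final segment. Index
  \<open>i\<close> lies outside it exactly when that segment is shorter than the part of the list
  starting at \<open>i\<close>.\<close>

lemma sorted_nth_le_iff:
  fixes xs :: "'a::linorder list"
  assumes "sorted xs" "i < length xs"
  shows "xs ! i \<le> y \<longleftrightarrow> length (filter ((<) y) xs) < length xs - i"
proof
  assume le: "xs ! i \<le> y"
  have "{j. j < length xs \<and> y < xs ! j} \<subseteq> {i<..<length xs}"
  proof
    fix j assume "j \<in> {j. j < length xs \<and> y < xs ! j}"
    then have j: "j < length xs" "y < xs ! j" by auto
    have "\<not> j \<le> i"
      using sorted_nth_mono[OF assms(1), of j i] assms(2) j le by auto
    with j show "j \<in> {i<..<length xs}" by auto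
  qed
  then have "card {j. j < length xs \<and> y < xs ! j} \<le> card {i<..<length xs}"
    by (intro card_mono) auto
  with assms(2) show "length (filter ((<) y) xs) < length xs - i"
    by (simp add: length_filter_conv_card)
next
  assume less: "length (filter ((<) y) xs) < length xs - i"
  show "xs ! i \<le> y"
  proof (rule ccontr)
    assume nle: "\<not> xs ! i \<le> y"
    have "{i..<length xs} \<subseteq> {j. j < length xs \<and> y < xs ! j}"
    proof
      fix j assume "j \<in> {i..<length xs}"
      with sorted_nth_mono[OF assms(1), of i j] nle show "j \<in> {j. j < length xs \<and> y < xs ! j}"
        by auto
    qed
    then have "card {i..<length xs} \<le> card {j. j < length xs \<and> y < xs ! j}"
      by (intro card_mono) auto
    with less show False
      by (simp add: length_filter_conv_card)
  qed
qed

text \<open>This replaces an order statistic, a function of all variables at once, by a count of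
  separate events, to which independence applies.\<close>

lemma kth_largest_le_iff:
  assumes "1 \<le> k" "k \<le> n"
  shows "kth_largest k n x \<le> y \<longleftrightarrow> card {i \<in> {1..n}. y < x i} < k"
proof -
  let ?xs = "sort (map x [1..<Suc n])"
  have len: "length ?xs = n" by simp
  \<comment> \<open>Index \<open>k - 1\<close> of the descending list is index \<open>n - k\<close>
    of the ascending one, both counted from 0.\<close>
  have "kth_largest k n x = ?xs ! (n - k)"
    unfolding kth_largest_def using assms by (simp add: rev_nth del: upt_Suc)
  moreover have "?xs ! (n - k) \<le> y \<longleftrightarrow> length (filter ((<) y) ?xs) < n - (n - k)"
    using sorted_nth_le_iff[of ?xs "n - k" y] assms by simp
  moreover have "length (filter ((<) y) ?xs) = length (filter (\<lambda>i. y < x i) [1..<Suc n])"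
    by (simp add: filter_sort filter_map comp_def del: upt_Suc)
  moreover have "\<dots> = card {i \<in> {1..n}. y < x i}"
    by (subst distinct_card[symmetric]) (auto intro!: arg_cong[where f = card] simp del: upt_Suc)
  ultimately show ?thesis using assms by simp
qed

section \<open>Binomial counts and their Poisson limit\<close>

text \<open>The event splits according to the exact set \<open>S\<close> of indices whose variable
  hits its target. By independence the probability of each pattern depends only on
  \<open>card S\<close>, and grouping patterns by cardinality gives the binomial sum.\<close>

lemma (in prob_space) prob_card_less_indep:
  fixes X :: "'i \<Rightarrow> 'a \<Rightarrow> 'b"
  assumes indep: "indep_vars N X I" and I: "finite I" "I \<noteq> {}"
    and A: "\<And>i. i \<in> I \<Longrightarrow> A i \<in> sets (N i)"
    and p: "\<And>i. i \<in> I \<Longrightarrow> prob {\<omega> \<in> space M. X i \<omega> \<in> A i} = p"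
  shows "prob {\<omega> \<in> space M. card {i \<in> I. X i \<omega> \<in> A i} < k} =
    (\<Sum>j<k. real (card I choose j) * p ^ j * (1 - p) ^ (card I - j))"
proof -
  \<comment> \<open>\<open>C S\<close> is the event that \<open>S\<close> is exactly the set of
    indices that hit.\<close>
  define B where "B S i = (if i \<in> S then A i else space (N i) - A i)" for S i
  define C where "C S = (\<Inter>i\<in>I. X i -` B S i \<inter> space M)" for S
  have rv: "random_variable (N i) (X i)" if "i \<in> I" for i
    using indep that unfolding indep_vars_def2 by auto
  have B: "B S i \<in> sets (N i)" if "i \<in> I" for S i
    using A[OF that] by (auto simp: B_def)
  have C_eq: "C S = {\<omega> \<in> space M. {i \<in> I. X i \<omega> \<in> A i} = S}" if "S \<subseteq> I" for S
  proof -
    have "\<omega> \<in> C S \<longleftrightarrow> {i \<in> I. X i \<omega> \<in> A i} = S" if "\<omega> \<in> space M" for \<omega>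
    proof -
      have "\<omega> \<in> C S \<longleftrightarrow> (\<forall>i\<in>I. X i \<omega> \<in> A i \<longleftrightarrow> i \<in> S)"
        using \<open>\<omega> \<in> space M\<close> measurable_space[OF rv] by (auto simp: C_def B_def)
      also have "\<dots> \<longleftrightarrow> {i \<in> I. X i \<omega> \<in> A i} = S"
        using \<open>S \<subseteq> I\<close> by blast
      finally show ?thesis .
    qed
    \<comment> \<open>An intersection over an empty \<open>I\<close> would be \<open>UNIV\<close>;
      nonemptiness keeps \<open>C S\<close> inside the space.\<close>
    moreover have "C S \<subseteq> space M"
      using I(2) by (auto simp: C_def)
    ultimately show ?thesis by blast
  qed
  have prob_C: "prob (C S) = p ^ card S * (1 - p) ^ (card I - card S)" if S: "S \<subseteq> I" for S
  proof -
    have "prob (C S) = (\<Prod>i\<in>I. prob (X i -` B S i \<inter> space M))"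
      unfolding C_def using indep_varsD_finite[OF indep I(2,1)] B by blast
    also have "\<dots> = (\<Prod>i\<in>I. if i \<in> S then p else 1 - p)"
    proof (rule prod.cong)
      fix i assume i: "i \<in> I"
      have eq: "X i -` A i \<inter> space M = {\<omega> \<in> space M. X i \<omega> \<in> A i}" by auto
      have "X i -` (space (N i) - A i) \<inter> space M = space M - (X i -` A i \<inter> space M)"
        using measurable_space[OF rv[OF i]] by auto
      then have "prob (X i -` (space (N i) - A i) \<inter> space M) = 1 - p"
        using prob_compl[OF measurable_sets[OF rv[OF i] A[OF i]]] p[OF i] eq by simp
      then show "prob (X i -` B S i \<inter> space M) = (if i \<in> S then p else 1 - p)"
        using p[OF i] eq by (simp add: B_def)
    qed simp
    also have "\<dots> = p ^ card S * (1 - p) ^ card (I - S)"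
      using I(1) S by (subst prod.If_cases) (auto simp: Int_absorb1 Diff_eq)
    finally show ?thesis
      using S I(1) by (simp add: card_Diff_subset finite_subset)
  qed
  have "{\<omega> \<in> space M. card {i \<in> I. X i \<omega> \<in> A i} < k} = (\<Union>S\<in>{S. S \<subseteq> I \<and> card S < k}. C S)"
    (is "?E = \<Union> (C ` ?F)")
  proof -
    have "(\<Union>S\<in>?F. C S) = (\<Union>S\<in>?F. {\<omega> \<in> space M. {i \<in> I. X i \<omega> \<in> A i} = S})"
      using C_eq by (intro SUP_cong) auto
    then show ?thesis by auto
  qed
  moreover have "prob (\<Union>S\<in>?F. C S) = (\<Sum>S\<in>?F. prob (C S))"
  proof (rule finite_measure_finite_Union)
    show "finite ?F" using I(1) by simp
    show "C ` ?F \<subseteq> events"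
      using I B rv by (auto simp: C_def intro!: sets.finite_INT measurable_sets)
    show "disjoint_family_on C ?F"
      by (auto simp: disjoint_family_on_def C_eq)
  qed
  moreover have "?F = (\<Union>j\<in>{..<k}. {S. S \<subseteq> I \<and> card S = j})" by auto
  moreover have "(\<Sum>S\<in>(\<Union>j\<in>{..<k}. {S. S \<subseteq> I \<and> card S = j}). prob (C S))
      = (\<Sum>j<k. \<Sum>S\<in>{S. S \<subseteq> I \<and> card S = j}. prob (C S))"
    using I(1) by (intro sum.UNION_disjoint) auto
  moreover have "(\<Sum>S\<in>{S. S \<subseteq> I \<and> card S = j}. prob (C S))
      = real (card I choose j) * p ^ j * (1 - p) ^ (card I - j)" for j
  proof -
    have "(\<Sum>S\<in>{S. S \<subseteq> I \<and> card S = j}. prob (C S))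
        = (\<Sum>S\<in>{S. S \<subseteq> I \<and> card S = j}. p ^ j * (1 - p) ^ (card I - j))"
      by (intro sum.cong) (auto simp: prob_C)
    then show ?thesis
      by (simp add: n_subsets[OF I(1)])
  qed
  ultimately show ?thesis by simp
qed

text \<open>The term splits into \<open>(n choose j) * p n ^ j\<close>, a product of
  \<open>j\<close> factors each tending to \<open>r\<close>, divided by \<open>fact j\<close>, and a
  power of \<open>1 - p n\<close> that is compared with \<open>(1 - r / n) ^ n\<close>.\<close>

lemma tendsto_binomial_poisson:
  fixes p :: "nat \<Rightarrow> real"
  assumes lim: "(\<lambda>n. real n * p n) \<longlonglongrightarrow> r"
    and p01: "\<forall>\<^sub>F n in sequentially. 0 \<le> p n \<and> p n \<le> 1"
  shows "(\<lambda>n. real (n choose j) * p n ^ j * (1 - p n) ^ (n - j)) \<longlonglongrightarrow> r ^ j / fact j * exp (- r)"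
proof -
  have inv: "(\<lambda>n. inverse (real n)) \<longlonglongrightarrow> 0"
    by (rule LIMSEQ_inverse_real_of_nat[THEN LIMSEQ_imp_Suc])
  have p0: "p \<longlonglongrightarrow> 0"
  proof (rule Lim_transform_eventually)
    show "(\<lambda>n. real n * p n * inverse (real n)) \<longlonglongrightarrow> 0"
      using tendsto_mult[OF lim inv] by simp
    show "\<forall>\<^sub>F n in sequentially. real n * p n * inverse (real n) = p n"
      using eventually_gt_at_top[of 0] by eventually_elim simp
  qed
  have "0 \<le> r"
  proof (rule tendsto_lowerbound[OF lim])
    show "\<forall>\<^sub>F n in sequentially. 0 \<le> real n * p n"
      using p01 by eventually_elim simp
  qed simp
  have choose: "(\<lambda>n. real (n choose j) * p n ^ j) \<longlonglongrightarrow> r ^ j / fact j"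
  proof -
    \<comment> \<open>The binomial coefficient is a falling factorial over \<open>fact j\<close>;
      each of its \<open>j\<close> factors receives one copy of \<open>p n\<close>.\<close>
    have "real (n choose j) * p n ^ j = (\<Prod>i = 0..<j. real n * p n - real i * p n) / fact j" for n
      by (simp add: binomial_gbinomial gbinomial_prod_rev left_diff_distrib[symmetric] prod.distrib)
    moreover have "(\<lambda>n. (\<Prod>i = 0..<j. real n * p n - real i * p n) / fact j)
        \<longlonglongrightarrow> (\<Prod>i = 0..<j. r - real i * 0) / fact j"
      by (intro tendsto_intros lim p0) simp
    ultimately show ?thesis by simp
  qed
  have "(\<lambda>n. (1 - p n) ^ n - (1 + - r / real n) ^ n) \<longlonglongrightarrow> 0"
  proof (rule Lim_null_comparison)
    show "(\<lambda>n. norm (real n * p n - r)) \<longlonglongrightarrow> 0"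
      using tendsto_norm[OF tendsto_diff[OF lim tendsto_const[of r]]] by simp
    show "\<forall>\<^sub>F n in sequentially. norm ((1 - p n) ^ n - (1 + - r / real n) ^ n) \<le> norm (real n * p n - r)"
      using p01 eventually_ge_at_top[of "nat \<lceil>r\<rceil> + 1"]
    proof eventually_elim
      case (elim n)
      \<comment> \<open>These bounds put \<open>1 - r / n\<close> in [0,1]. For two numbers of
        modulus at most 1, the n-th powers differ by at most n times the difference of the
        numbers.\<close>
      then have n: "0 < real n" "r \<le> real n" by linarith+
      have "norm ((1 - p n) ^ n - (1 + - r / real n) ^ n) \<le> real n * norm ((1 - p n) - (1 + - r / real n))"
        using elim n \<open>0 \<le> r\<close> by (intro norm_power_diff) (auto simp: field_simps abs_le_iff)
      also have "\<dots> = norm (real n * (r / real n - p n))"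
        by (simp add: abs_mult)
      also have "\<dots> = norm (real n * p n - r)"
        using n by (simp add: right_diff_distrib norm_minus_commute)
      finally show ?case .
    qed
  qed
  from tendsto_add[OF this tendsto_exp_limit_sequentially[of "- r"]]
  have pow: "(\<lambda>n. (1 - p n) ^ n) \<longlonglongrightarrow> exp (- r)" by simp
  have "(\<lambda>n. (1 - p n) ^ (n - j)) \<longlonglongrightarrow> exp (- r)"
  proof (rule Lim_transform_eventually)
    show "(\<lambda>n. (1 - p n) ^ n / (1 - p n) ^ j) \<longlonglongrightarrow> exp (- r)"
      using tendsto_divide[OF pow tendsto_power[OF tendsto_diff[OF tendsto_const[of 1] p0], of j]] by simp
    show "\<forall>\<^sub>F n in sequentially. (1 - p n) ^ n / (1 - p n) ^ j = (1 - p n) ^ (n - j)"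
      using order_tendstoD(2)[OF p0 zero_less_one] eventually_ge_at_top[of j]
      by eventually_elim (simp add: power_diff)
  qed
  from tendsto_mult[OF choose this] show ?thesis .
qed

section \<open>Gumbel normalisation from tail ratios\<close>

text \<open>At a constant shift \<open>\<kappa> * v\<close> the claim is \<open>ratio\<close>
  evaluated along \<open>\<eta> n\<close>, where dividing by \<open>T (\<eta> n)\<close> means
  multiplying by \<open>n\<close>. A varying shift is squeezed between constant ones by monotonicity
  of \<open>T\<close>, and continuity of exp closes the gap.\<close>

lemma gumbel_tail_tendsto:
  fixes T :: "real \<Rightarrow> real" and \<eta> d :: "nat \<Rightarrow> real"
  assumes T: "antimono T" and \<kappa>: "0 < \<kappa>"
    and ratio: "\<And>v. ((\<lambda>x. T (x + \<kappa> * v) / T x) \<longlongrightarrow> exp (- v)) at_top"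
    and \<eta>_lim: "filterlim \<eta> at_top sequentially"
    and \<eta>: "\<forall>\<^sub>F n in sequentially. T (\<eta> n) = 1 / real n"
    and d: "d \<longlonglongrightarrow> \<kappa> * v"
  shows "(\<lambda>n. real n * T (\<eta> n + d n)) \<longlonglongrightarrow> exp (- v)"
proof -
  have *: "(\<lambda>n. real n * T (\<eta> n + \<kappa> * v)) \<longlonglongrightarrow> exp (- v)" for v
  proof (rule Lim_transform_eventually)
    show "(\<lambda>n. T (\<eta> n + \<kappa> * v) / T (\<eta> n)) \<longlonglongrightarrow> exp (- v)"
      by (rule filterlim_compose[OF ratio \<eta>_lim])
    show "\<forall>\<^sub>F n in sequentially. T (\<eta> n + \<kappa> * v) / T (\<eta> n) = real n * T (\<eta> n + \<kappa> * v)"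
      using \<eta> by eventually_elim simp
  qed
  show "(\<lambda>n. real n * T (\<eta> n + d n)) \<longlonglongrightarrow> exp (- v)"
  proof (rule order_tendstoI)
    have cont: "((\<lambda>w. exp (- w)) \<longlongrightarrow> exp (- v)) (at v)"
      by (intro tendsto_intros)
    {
      \<comment> \<open>With \<open>w\<close> slightly to the right of \<open>v\<close>, eventually
        \<open>d n < \<kappa> * w\<close>, so the smaller tail at the constant shift
        \<open>\<kappa> * w\<close> is a lower bound. The upper bound uses \<open>w\<close> to the
        left of \<open>v\<close>.\<close>
      fix a assume "a < exp (- v)"
      then have "\<forall>\<^sub>F w in at_right v. a < exp (- w)"
        using order_tendstoD(1)[OF cont] by (simp add: eventually_at_split)
      moreover have "\<forall>\<^sub>F w in at_right v. v < w"
        by (rule eventually_at_right_less)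
      ultimately obtain w where w: "a < exp (- w)" "v < w"
        using eventually_happens'[OF trivial_limit_at_right_real eventually_conj] by blast
      have less: "\<kappa> * v < \<kappa> * w" using \<kappa> w(2) by simp
      from order_tendstoD(2)[OF d less] order_tendstoD(1)[OF *[of w] w(1)]
      show "\<forall>\<^sub>F n in sequentially. a < real n * T (\<eta> n + d n)"
      proof eventually_elim
        case (elim n)
        have "T (\<eta> n + \<kappa> * w) \<le> T (\<eta> n + d n)"
          using elim by (intro antimonoD[OF T]) simp
        then show ?case
          using elim mult_left_mono[of _ _ "real n"] by fastforce
      qed
    next
      fix a assume "exp (- v) < a"
      then have "\<forall>\<^sub>F w in at_left v. exp (- w) < a"
        using order_tendstoD(2)[OF cont] by (simp add: eventually_at_split)
      moreover have "\<forall>\<^sub>F w in at_left v. w < v"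
        by (simp add: eventually_at_filter)
      ultimately obtain w where w: "exp (- w) < a" "w < v"
        using eventually_happens'[OF trivial_limit_at_left_real eventually_conj] by blast
      have less: "\<kappa> * w < \<kappa> * v" using \<kappa> w(2) by simp
      from order_tendstoD(1)[OF d less] order_tendstoD(2)[OF *[of w] w(1)]
      show "\<forall>\<^sub>F n in sequentially. real n * T (\<eta> n + d n) < a"
      proof eventually_elim
        case (elim n)
        have "T (\<eta> n + d n) \<le> T (\<eta> n + \<kappa> * w)"
          using elim by (intro antimonoD[OF T]) simp
        then show ?case
          using elim mult_left_mono[of _ _ "real n"] by fastforce
      qed
    }
  qed
qed

text \<open>The scaled tail is \<open>exp (- 1)\<close> at shift \<open>\<xi> n\<close> and tends to
  \<open>exp (- (a / \<kappa>))\<close> at shift \<open>a\<close>. For \<open>a\<close> different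
  from \<kappa> these differ strictly in the limit, and monotonicity of \<open>T\<close> turns the
  comparison of tails into one of \<open>a\<close> with \<open>\<xi> n\<close>.\<close>

lemma gumbel_scale_tendsto:
  fixes T :: "real \<Rightarrow> real" and \<eta> \<xi> :: "nat \<Rightarrow> real"
  assumes T: "antimono T" and \<kappa>: "0 < \<kappa>"
    and ratio: "\<And>v. ((\<lambda>x. T (x + \<kappa> * v) / T x) \<longlongrightarrow> exp (- v)) at_top"
    and \<eta>_lim: "filterlim \<eta> at_top sequentially"
    and \<eta>: "\<forall>\<^sub>F n in sequentially. T (\<eta> n) = 1 / real n"
    and \<xi>: "\<forall>\<^sub>F n in sequentially. T (\<eta> n + \<xi> n) = 1 / (exp 1 * real n)"
  shows "\<xi> \<longlonglongrightarrow> \<kappa>"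
proof -
  have lim: "(\<lambda>n. real n * T (\<eta> n + a)) \<longlonglongrightarrow> exp (- (a / \<kappa>))" for a
    using \<kappa> by (intro gumbel_tail_tendsto[OF T \<kappa> ratio \<eta>_lim \<eta>]) simp
  have \<xi>': "\<forall>\<^sub>F n in sequentially. real n * T (\<eta> n + \<xi> n) = exp (- 1)"
    using \<xi> eventually_gt_at_top[of 0] by eventually_elim (simp add: exp_minus field_simps)
  show ?thesis
  proof (rule order_tendstoI)
    fix a assume "a < \<kappa>"
    then have "exp (- 1) < exp (- (a / \<kappa>))" using \<kappa> by simp
    from order_tendstoD(1)[OF lim this] \<xi>'
    show "\<forall>\<^sub>F n in sequentially. a < \<xi> n"
    proof eventually_elim
      case (elim n)
      then have "real n * T (\<eta> n + \<xi> n) < real n * T (\<eta> n + a)" by simp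
      then have "T (\<eta> n + \<xi> n) < T (\<eta> n + a)"
        by (simp add: mult_less_cancel_left)
      with antimonoD[OF T, of "\<eta> n + \<xi> n" "\<eta> n + a"] show ?case
        by (rule_tac ccontr) simp
    qed
  next
    fix a assume "\<kappa> < a"
    then have "exp (- (a / \<kappa>)) < exp (- 1)" using \<kappa> by simp
    from order_tendstoD(2)[OF lim this] \<xi>'
    show "\<forall>\<^sub>F n in sequentially. \<xi> n < a"
    proof eventually_elim
      case (elim n)
      then have "real n * T (\<eta> n + a) < real n * T (\<eta> n + \<xi> n)" by simp
      then have "T (\<eta> n + a) < T (\<eta> n + \<xi> n)"
        by (simp add: mult_less_cancel_left)
      with antimonoD[OF T, of "\<eta> n + a" "\<eta> n + \<xi> n"] show ?case
        by (rule_tac ccontr) simp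
    qed
  qed
qed

section \<open>Shift ratios of Laplace transforms\<close>

text \<open>As \<open>s\<close> grows, the weight \<open>exp (- (s * W x))\<close> concentrates
  where \<open>W\<close> is near 0, and there the extra factor \<open>exp (- (v * W x))\<close> is
  close to 1. Hypothesis \<open>small\<close> guarantees mass arbitrarily near 0.\<close>

lemma (in prob_space) laplace_transform_shift_ratio_nonneg:
  fixes W :: "'a \<Rightarrow> real"
  assumes W[measurable]: "random_variable borel W" and nonneg: "AE x in M. 0 \<le> W x"
    and small: "\<And>e. 0 < e \<Longrightarrow> 0 < prob {x \<in> space M. W x \<le> e}"
    and v: "0 \<le> v"
  shows "((\<lambda>s. expectation (\<lambda>x. exp (- ((s + v) * W x))) / expectation (\<lambda>x. exp (- (s * W x))))
    \<longlongrightarrow> 1) at_top"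
proof -
  define \<phi> where "\<phi> s = expectation (\<lambda>x. exp (- (s * W x)))" for s
  have int: "integrable M (\<lambda>x. exp (- (s * W x)))" if "0 \<le> s" for s
    using nonneg that by (intro integrable_const_bound[of _ 1]) auto
  have lower: "exp (- (s * e)) * prob {x \<in> space M. W x \<le> e} \<le> \<phi> s" if "0 \<le> s" for s e
  proof -
    have "expectation (\<lambda>x. exp (- (s * e)) * indicator {x \<in> space M. W x \<le> e} x) \<le> \<phi> s"
      unfolding \<phi>_def
    proof (rule integral_mono_AE)
      show "AE x in M. exp (- (s * e)) * indicator {x \<in> space M. W x \<le> e} x \<le> exp (- (s * W x))"
        using that by (auto simp: indicator_def mult_left_mono)
    qed (use int that in \<open>auto simp: integrable_indicator_iff emeasure_eq_measure\<close>)
    then show ?thesis by simp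
  qed
  have pos: "0 < \<phi> s" if "0 \<le> s" for s
    using less_le_trans[OF mult_pos_pos[OF exp_gt_zero small[of 1]] lower[OF that]] by simp
  have upper_ratio: "\<phi> (s + v) / \<phi> s \<le> 1" if "0 \<le> s" for s
  proof -
    have "\<phi> (s + v) \<le> \<phi> s"
      unfolding \<phi>_def
    proof (intro integral_mono_AE int)
      show "AE x in M. exp (- ((s + v) * W x)) \<le> exp (- (s * W x))"
        using nonneg by eventually_elim (use v in \<open>simp add: distrib_right\<close>)
    qed (use that v in auto)
    then show ?thesis using pos[OF that] by simp
  qed
  \<comment> \<open>The mass where \<open>W > e\<close> contributes at most \<open>exp (- s e)\<close>, which is negligible against
    the contribution of the mass where \<open>W \<le> e / 2\<close>.\<close>
  have lower_ratio: "exp (- (v * e)) * (1 - exp (- (s * (e / 2))) / prob {x \<in> space M. W x \<le> e / 2})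
      \<le> \<phi> (s + v) / \<phi> s" if s: "0 \<le> s" and e: "0 < e" for s e
  proof -
    let ?q = "prob {x \<in> space M. W x \<le> e / 2}"
    \<comment> \<open>This pointwise bound avoids splitting the integral: where
      \<open>W x \<le> e\<close> the factor \<open>exp (- (v * W x))\<close> is at least
      \<open>exp (- (v * e))\<close>, and where \<open>W x > e\<close> the left side is
      nonpositive.\<close>
    have "expectation (\<lambda>x. exp (- (v * e)) * (exp (- (s * W x)) - exp (- (s * e)))) \<le> \<phi> (s + v)"
      unfolding \<phi>_def
    proof (rule integral_mono_AE)
      show "AE x in M. exp (- (v * e)) * (exp (- (s * W x)) - exp (- (s * e))) \<le> exp (- ((s + v) * W x))"
      proof (rule AE_I2)
        fix x
        show "exp (- (v * e)) * (exp (- (s * W x)) - exp (- (s * e))) \<le> exp (- ((s + v) * W x))"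
        proof (cases "W x \<le> e")
          case True
          have "exp (- (v * e)) * (exp (- (s * W x)) - exp (- (s * e)))
              \<le> exp (- (v * W x)) * exp (- (s * W x))"
            using True v s by (intro mult_mono') (auto intro: mult_left_mono)
          then show ?thesis
            by (simp add: exp_add[symmetric] algebra_simps)
        next
          case False
          then have "exp (- (s * W x)) \<le> exp (- (s * e))"
            using s by (simp add: mult_left_mono)
          then have "exp (- (v * e)) * (exp (- (s * W x)) - exp (- (s * e))) \<le> 0"
            by (simp add: mult_le_0_iff)
          then show ?thesis
            using exp_ge_zero order_trans by blast
        qed
      qed
    qed (use int s v in auto)
    then have "exp (- (v * e)) * (\<phi> s - exp (- (s * e))) \<le> \<phi> (s + v)"
      using int[OF s] by (simp add: \<phi>_def prob_space)
    then have 1: "exp (- (v * e)) * (\<phi> s - exp (- (s * e))) / \<phi> s \<le> \<phi> (s + v) / \<phi> s"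
      using pos[OF s] by (intro divide_right_mono) auto
    \<comment> \<open>Half of the exponent is spent on the lower bound for \<open>\<phi> s\<close>;
      the other half remains as decay in \<open>s\<close>.\<close>
    have "exp (- (s * e)) * ?q = exp (- (s * (e / 2))) * (exp (- (s * (e / 2))) * ?q)"
      by (simp add: mult.assoc[symmetric] exp_add[symmetric])
    also have "\<dots> \<le> exp (- (s * (e / 2))) * \<phi> s"
      using lower[OF s, of "e / 2"] by simp
    finally have "exp (- (s * e)) / \<phi> s \<le> exp (- (s * (e / 2))) / ?q"
      using small[of "e / 2"] e pos[OF s] by (simp add: field_simps)
    then have "exp (- (v * e)) * (1 - exp (- (s * (e / 2))) / ?q)
        \<le> exp (- (v * e)) * (1 - exp (- (s * e)) / \<phi> s)"
      by (intro mult_left_mono) auto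
    also have "\<dots> = exp (- (v * e)) * (\<phi> s - exp (- (s * e))) / \<phi> s"
      using pos[OF s] by (simp add: field_simps)
    finally show ?thesis using 1 by simp
  qed
  have "((\<lambda>s. \<phi> (s + v) / \<phi> s) \<longlongrightarrow> 1) at_top"
  proof (rule order_tendstoI)
    fix a :: real assume "1 < a"
    show "\<forall>\<^sub>F s in at_top. \<phi> (s + v) / \<phi> s < a"
      using eventually_ge_at_top[of "0 :: real"]
      by eventually_elim (use upper_ratio \<open>1 < a\<close> in \<open>blast intro: le_less_trans\<close>)
  next
    fix a :: real assume "a < 1"
    have "((\<lambda>e. exp (- (v * e))) \<longlongrightarrow> exp (- (v * 0))) (at_right 0)"
      by (intro tendsto_intros)
    then have "\<forall>\<^sub>F e in at_right 0. a < exp (- (v * e))"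
      using \<open>a < 1\<close> by (intro order_tendstoD(1)) auto
    \<comment> \<open>The order of choices matters: \<open>e\<close> is fixed first, then
      \<open>s\<close> grows and the correction term vanishes.\<close>
    then obtain e where e: "0 < e" "a < exp (- (v * e))"
      using eventually_happens'[OF trivial_limit_at_right_real
          eventually_conj[OF eventually_at_right_less[of 0]]] by blast
    have "((\<lambda>s. exp (- (v * e)) * (1 - exp (- (s * (e / 2))) / prob {x \<in> space M. W x \<le> e / 2}))
        \<longlongrightarrow> exp (- (v * e)) * (1 - 0 / prob {x \<in> space M. W x \<le> e / 2})) at_top"
    proof (intro tendsto_intros)
      have "filterlim (\<lambda>s. s * (e / 2)) at_top at_top"
        using e(1) by (intro filterlim_at_top_mult_tendsto_pos[OF tendsto_const] filterlim_ident) auto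
      then show "((\<lambda>s. exp (- (s * (e / 2)))) \<longlongrightarrow> 0) at_top"
        by (intro filterlim_compose[OF exp_at_bot] filterlim_compose[OF filterlim_uminus_at_bot_at_top])
      show "prob {x \<in> space M. W x \<le> e / 2} \<noteq> 0"
        using small[of "e / 2"] e(1) by simp
    qed
    then have "\<forall>\<^sub>F s in at_top. a < exp (- (v * e)) *
        (1 - exp (- (s * (e / 2))) / prob {x \<in> space M. W x \<le> e / 2})"
      using e(2) by (intro order_tendstoD(1)) auto
    with eventually_ge_at_top[of "0 :: real"]
    show "\<forall>\<^sub>F s in at_top. a < \<phi> (s + v) / \<phi> s"
      by eventually_elim (use lower_ratio e(1) in \<open>blast intro: less_le_trans\<close>)
  qed
  then show ?thesis by (simp add: \<phi>_def)
qed

text \<open>For negative \<open>v\<close>, the nonnegative case with shift \<open>- v\<close> is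
  taken at the point \<open>s + v\<close>, which gives the reciprocal ratio.\<close>

lemma (in prob_space) laplace_transform_shift_ratio:
  fixes W :: "'a \<Rightarrow> real"
  assumes W: "random_variable borel W" and nonneg: "AE x in M. 0 \<le> W x"
    and small: "\<And>e. 0 < e \<Longrightarrow> 0 < prob {x \<in> space M. W x \<le> e}"
  shows "((\<lambda>s. expectation (\<lambda>x. exp (- ((s + v) * W x))) / expectation (\<lambda>x. exp (- (s * W x))))
    \<longlongrightarrow> 1) at_top"
proof (cases "0 \<le> v")
  case True
  then show ?thesis by (intro laplace_transform_shift_ratio_nonneg assms)
next
  case False
  have "filterlim (\<lambda>s. s + v) at_top at_top"
    using filterlim_tendsto_add_at_top[OF tendsto_const filterlim_ident, of v] by (simp add: add.commute)
  moreover have "((\<lambda>s. expectation (\<lambda>x. exp (- ((s + - v) * W x))) / expectation (\<lambda>x. exp (- (s * W x))))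
    \<longlongrightarrow> 1) at_top"
    using False by (intro laplace_transform_shift_ratio_nonneg assms) auto
  ultimately have "((\<lambda>s. expectation (\<lambda>x. exp (- ((s + v + - v) * W x))) /
      expectation (\<lambda>x. exp (- ((s + v) * W x)))) \<longlongrightarrow> 1) at_top"
    by (rule filterlim_compose[rotated])
  then have "((\<lambda>s. expectation (\<lambda>x. exp (- (s * W x))) / expectation (\<lambda>x. exp (- ((s + v) * W x))))
    \<longlongrightarrow> 1) at_top" by simp
  from tendsto_inverse[OF this] show ?thesis by simp
qed

section \<open>The tail of the SNR\<close>

abbreviation (input) exp1 :: "real measure" where
  "exp1 \<equiv> density lborel (exponential_density 1)"

text \<open>
  The probability that \<open>|h|\<^sup>2 |g|\<^sup>2 / (|g|\<^sup>2 + \<gamma>)\<close> exceeds \<open>s \<ge> 0\<close>. The integral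
  is \<open>2 * sqrt (s * \<gamma>) * K1 (2 * sqrt (s * \<gamma>))\<close>, but the Bessel function is never needed.
\<close>

definition snr_tail :: "real \<Rightarrow> real \<Rightarrow> real" where
  "snr_tail \<gamma> s = exp (- s) * (\<integral>y. exp (- (s * (\<gamma> / y))) \<partial>exp1)"

lemma AE_exp1_pos: "AE y in exp1. 0 < y"
  \<comment> \<open>The density does not vanish at 0, so the point 0 is discarded as a Lebesgue null
    set.\<close>
  by (subst AE_density) (auto simp: exponential_density_def intro!: AE_I[where N = "{0}"])

lemma measure_exp1_greaterThan:
  assumes "0 \<le> r"
  shows "measure exp1 {r<..} = exp (- r)"
proof -
  interpret E: prob_space exp1
    by (rule prob_space_exponential_density) simp
  \<comment> \<open>The identity on \<open>exp1\<close> is itself an exponential variable, so the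
    known tail formula applies to it.\<close>
  have "distributed exp1 lborel (\<lambda>y. y) (exponential_density 1)"
    by (auto simp: distributed_def distr_id2)
  from E.exponential_distributedD_gt[OF this assms] show ?thesis
    by (simp add: greaterThan_def)
qed

lemma snr_tail_integrable:
  assumes "0 \<le> s" "0 < \<gamma>"
  shows "integrable exp1 (\<lambda>y. exp (- (s * (\<gamma> / y))))"
proof -
  interpret E: prob_space exp1
    by (rule prob_space_exponential_density) simp
  show ?thesis
    using AE_exp1_pos assms by (intro E.integrable_const_bound[of _ 1]) auto
qed

text \<open>The prefactor \<open>exp (- s)\<close> contributes exactly \<open>exp (- v)\<close>, and
  the Laplace transform of \<open>\<gamma> / y\<close> contributes a ratio tending to 1. Small
  values of \<open>\<gamma> / y\<close> have positive mass because the exponential law is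
  unbounded.\<close>

lemma snr_tail_ratio_tendsto:
  assumes "0 < \<gamma>"
  shows "((\<lambda>s. snr_tail \<gamma> (s + v) / snr_tail \<gamma> s) \<longlongrightarrow> exp (- v)) at_top"
proof -
  interpret E: prob_space exp1
    by (rule prob_space_exponential_density) simp
  have "0 < measure exp1 {y \<in> space exp1. \<gamma> / y \<le> e}" if "0 < e" for e
  proof -
    have "{\<gamma> / e<..} \<subseteq> {y \<in> space exp1. \<gamma> / y \<le> e}"
    proof
      fix y assume "y \<in> {\<gamma> / e<..}"
      moreover from this have "0 < y"
        using assms that by (meson divide_pos_pos greaterThan_iff less_trans)
      ultimately show "y \<in> {y \<in> space exp1. \<gamma> / y \<le> e}"
        using that by (auto simp: field_simps)
    qed
    then have "measure exp1 {\<gamma> / e<..} \<le> measure exp1 {y \<in> space exp1. \<gamma> / y \<le> e}"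
      by (intro E.finite_measure_mono) auto
    moreover have "0 < measure exp1 {\<gamma> / e<..}"
      using measure_exp1_greaterThan[of "\<gamma> / e"] assms that by simp
    ultimately show ?thesis by simp
  qed
  moreover have "AE y in exp1. 0 \<le> \<gamma> / y"
    using AE_exp1_pos by eventually_elim (use assms in simp)
  ultimately have "((\<lambda>s. (\<integral>y. exp (- ((s + v) * (\<gamma> / y))) \<partial>exp1) / (\<integral>y. exp (- (s * (\<gamma> / y))) \<partial>exp1))
      \<longlongrightarrow> 1) at_top"
    by (intro E.laplace_transform_shift_ratio) auto
  from tendsto_mult[OF tendsto_const[of "exp (- v)"] this]
  have "((\<lambda>s. exp (- v) * ((\<integral>y. exp (- ((s + v) * (\<gamma> / y))) \<partial>exp1) / (\<integral>y. exp (- (s * (\<gamma> / y))) \<partial>exp1)))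
      \<longlongrightarrow> exp (- v)) at_top" by simp
  moreover have "exp (- (s + v)) = exp (- v) * exp (- s)" for s
    by (simp add: exp_add[symmetric])
  ultimately show ?thesis
    by (simp add: snr_tail_def mult.assoc)
qed

lemma snr_tail_0: "snr_tail \<gamma> 0 = 1"
  using prob_space.prob_space[OF prob_space_exponential_density[of 1]]
  by (simp add: snr_tail_def)

lemma snr_tail_pos:
  assumes "0 \<le> s" "0 < \<gamma>"
  shows "0 < snr_tail \<gamma> s"
proof -
  interpret E: prob_space exp1
    by (rule prob_space_exponential_density) simp
  have "(\<integral>y. exp (- (s * (\<gamma> / y))) \<partial>exp1) \<noteq> 0"
  proof
    assume "(\<integral>y. exp (- (s * (\<gamma> / y))) \<partial>exp1) = 0"
    then have "AE y in exp1. exp (- (s * (\<gamma> / y))) = 0"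
      using integral_nonneg_eq_0_iff_AE[OF snr_tail_integrable[OF assms]] by simp
    then have "AE y in exp1. False" by simp
    then show False by simp
  qed
  moreover have "0 \<le> (\<integral>y. exp (- (s * (\<gamma> / y))) \<partial>exp1)" by simp
  ultimately show ?thesis by (simp add: snr_tail_def less_le)
qed

text \<open>This explicit bound provides the right endpoint for the intermediate value argument on
  quantiles.\<close>

lemma snr_tail_le:
  assumes "0 \<le> s" "0 < \<gamma>"
  shows "snr_tail \<gamma> s \<le> exp (- s)"
proof -
  interpret E: prob_space exp1
    by (rule prob_space_exponential_density) simp
  have "(\<integral>y. exp (- (s * (\<gamma> / y))) \<partial>exp1) \<le> (\<integral>y. 1 \<partial>exp1)"
    using AE_exp1_pos assms by (intro integral_mono_AE snr_tail_integrable) auto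
  then show ?thesis using E.prob_space by (simp add: snr_tail_def)
qed

text \<open>Dominated convergence applies with majorant 1, since the exponent is nonpositive for
  \<open>s \<ge> 0\<close> and \<open>y > 0\<close>. Continuity makes the quantiles of the SNR
  attained values.\<close>

lemma continuous_on_snr_tail:
  assumes "0 < \<gamma>"
  shows "continuous_on {0..} (snr_tail \<gamma>)"
proof -
  interpret E: prob_space exp1
    by (rule prob_space_exponential_density) simp
  have "continuous_on {0..} (\<lambda>s. \<integral>y. exp (- (s * (\<gamma> / y))) \<partial>exp1)"
    unfolding continuous_on_sequentially comp_def
  proof safe
    fix x :: "nat \<Rightarrow> real" and a
    assume x: "\<forall>n. x n \<in> {0..}" "x \<longlonglongrightarrow> a"
    show "(\<lambda>n. \<integral>y. exp (- (x n * (\<gamma> / y))) \<partial>exp1) \<longlonglongrightarrow> (\<integral>y. exp (- (a * (\<gamma> / y))) \<partial>exp1)"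
    proof (rule integral_dominated_convergence)
      show "AE y in exp1. (\<lambda>n. exp (- (x n * (\<gamma> / y)))) \<longlonglongrightarrow> exp (- (a * (\<gamma> / y)))"
        using x(2) by (intro AE_I2 tendsto_intros)
      show "AE y in exp1. norm (exp (- (x n * (\<gamma> / y)))) \<le> 1" for n
        using AE_exp1_pos x(1) assms by auto
    qed auto
  qed
  then show ?thesis
    unfolding snr_tail_def by (intro continuous_intros)
qed

text \<open>The joint law is a product, so Fubini conditions on \<open>G\<close>. The slice at
  \<open>y > 0\<close> is a half-line starting at \<open>s * (1 + \<gamma> / y)\<close>, whose
  exponential mass factors as \<open>exp (- s) * exp (- (s * (\<gamma> / y)))\<close>.\<close>

lemma (in prob_space) prob_snr_tail:
  assumes G: "distributed M lborel G (exponential_density 1)"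
    and H: "distributed M lborel H (exponential_density 1)"
    and indep: "indep_var borel G borel H"
    and \<gamma>: "0 < \<gamma>" and s: "0 \<le> s"
  shows "prob {\<omega> \<in> space M. s * (1 + \<gamma> / G \<omega>) < H \<omega>} = snr_tail \<gamma> s"
proof -
  interpret E: prob_space exp1
    by (rule prob_space_exponential_density) simp
  have distr_exp: "distr M borel Y = exp1" if "distributed M lborel Y (exponential_density 1)" for Y
    using that distr_cong[OF refl sets_lborel, of M Y Y] by (simp add: distributed_def)
  have [measurable]: "random_variable borel G" "random_variable borel H"
    using G H by (auto simp: distributed_def)
  have joint: "distr M (borel \<Otimes>\<^sub>M borel) (\<lambda>\<omega>. (G \<omega>, H \<omega>)) = exp1 \<Otimes>\<^sub>M exp1"
    using indep by (simp add: indep_var_distribution_eq distr_exp G H)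
  define A where "A = {(y, z). s * (1 + \<gamma> / y) < (z :: real)}"
  have A: "A \<in> sets (borel \<Otimes>\<^sub>M borel)"
  proof -
    have "{p \<in> space (borel \<Otimes>\<^sub>M borel). s * (1 + \<gamma> / fst p) < (snd p :: real)} \<in> sets (borel \<Otimes>\<^sub>M borel)"
      by measurable
    also have "{p \<in> space (borel \<Otimes>\<^sub>M borel). s * (1 + \<gamma> / fst p) < (snd p :: real)} = A"
      by (auto simp: A_def space_pair_measure)
    finally show ?thesis .
  qed
  have sets_eq: "sets (exp1 \<Otimes>\<^sub>M exp1) = sets (borel \<Otimes>\<^sub>M borel)"
    by (intro sets_pair_measure_cong) auto
  have "emeasure M {\<omega> \<in> space M. s * (1 + \<gamma> / G \<omega>) < H \<omega>}
      = emeasure (distr M (borel \<Otimes>\<^sub>M borel) (\<lambda>\<omega>. (G \<omega>, H \<omega>))) A"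
    using A by (subst emeasure_distr) (auto simp: A_def intro!: arg_cong2[where f = emeasure])
  also have "\<dots> = (\<integral>\<^sup>+y. emeasure exp1 (Pair y -` A) \<partial>exp1)"
    using A sets_eq by (simp add: joint E.emeasure_pair_measure_alt)
  also have "\<dots> = (\<integral>\<^sup>+y. ennreal (exp (- s) * exp (- (s * (\<gamma> / y)))) \<partial>exp1)"
  proof (rule nn_integral_cong_AE)
    show "AE y in exp1. emeasure exp1 (Pair y -` A) = ennreal (exp (- s) * exp (- (s * (\<gamma> / y))))"
      using AE_exp1_pos
    proof eventually_elim
      case (elim y)
      have "Pair y -` A = {s * (1 + \<gamma> / y)<..}" by (auto simp: A_def)
      moreover have "0 \<le> s * (1 + \<gamma> / y)" using elim s \<gamma> by simp
      ultimately show ?case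
        by (simp add: E.emeasure_eq_measure measure_exp1_greaterThan exp_add[symmetric] algebra_simps)
    qed
  qed
  also have "\<dots> = ennreal (snr_tail \<gamma> s)"
    unfolding snr_tail_def using snr_tail_integrable[OF s \<gamma>]
    by (subst nn_integral_eq_integral) auto
  finally show ?thesis
    using snr_tail_pos[OF s \<gamma>] by (simp add: emeasure_eq_measure)
qed

section \<open>The limit law of the k-th largest value\<close>

text \<open>Knowing \<open>tail\<close> at nonnegative levels suffices, because the thresholds
  \<open>y n\<close> tend to infinity.\<close>

lemma (in prob_space) kth_largest_gumbel:
  fixes X :: "nat \<Rightarrow> 'a \<Rightarrow> real" and T :: "real \<Rightarrow> real" and \<eta> \<xi> :: "nat \<Rightarrow> real"
  assumes indep: "indep_vars (\<lambda>_. borel) X {1..}"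
    and tail: "\<And>i y. 1 \<le> i \<Longrightarrow> 0 \<le> y \<Longrightarrow> prob {\<omega> \<in> space M. y < X i \<omega>} = T y"
    and T: "antimono T" and T_pos: "\<And>y. 0 < T y" and \<kappa>: "0 < \<kappa>"
    and ratio: "\<And>v. ((\<lambda>x. T (x + \<kappa> * v) / T x) \<longlongrightarrow> exp (- v)) at_top"
    and \<eta>: "\<forall>\<^sub>F n in sequentially. T (\<eta> n) = 1 / real n"
    and \<xi>: "\<forall>\<^sub>F n in sequentially. T (\<eta> n + \<xi> n) = 1 / (exp 1 * real n)"
    and k: "1 \<le> k"
  shows "(\<lambda>n. prob {\<omega> \<in> space M. (kth_largest k n (\<lambda>i. X i \<omega>) - \<eta> n) / \<xi> n \<le> u})
    \<longlonglongrightarrow> exp (- exp (- u)) * (\<Sum>j<k. exp (- real j * u) / fact j)"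
proof -
  have \<eta>_lim: "filterlim \<eta> at_top sequentially"
    unfolding filterlim_at_top
  proof
    \<comment> \<open>Since \<open>T z\<close> is positive while \<open>T (\<eta> n) = 1 / n\<close>
      drops below it, \<open>\<eta> n\<close> must eventually pass any \<open>z\<close>.\<close>
    fix z
    have "\<forall>\<^sub>F n in sequentially. 1 / real n < T z"
      using order_tendstoD(2)[OF lim_1_over_n T_pos] by simp
    with \<eta> show "\<forall>\<^sub>F n in sequentially. z \<le> \<eta> n"
    proof eventually_elim
      case (elim n)
      with antimonoD[OF T, of "\<eta> n" z] show ?case by (rule_tac ccontr) simp
    qed
  qed
  have \<xi>_lim: "\<xi> \<longlonglongrightarrow> \<kappa>"
    by (rule gumbel_scale_tendsto[OF T \<kappa> ratio \<eta>_lim \<eta> \<xi>])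
  define y where "y n = \<eta> n + \<xi> n * u" for n
  have "(\<lambda>n. real n * T (y n)) \<longlonglongrightarrow> exp (- u)"
    unfolding y_def by (intro gumbel_tail_tendsto[OF T \<kappa> ratio \<eta>_lim \<eta>] tendsto_intros \<xi>_lim)
  moreover have y_lim: "filterlim y at_top sequentially"
    unfolding y_def using filterlim_tendsto_add_at_top[OF tendsto_mult_right[OF \<xi>_lim, of u] \<eta>_lim]
    by (simp add: add.commute)
  then have y0: "\<forall>\<^sub>F n in sequentially. 0 \<le> y n"
    by (simp add: filterlim_at_top)
  have T01: "0 \<le> T z \<and> T z \<le> 1" if "0 \<le> z" for z
    using tail[of 1 z, symmetric] that by simp
  have "\<forall>\<^sub>F n in sequentially. 0 \<le> T (y n) \<and> T (y n) \<le> 1"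
    using y0 by eventually_elim (rule T01)
  ultimately have "(\<lambda>n. real (n choose j) * T (y n) ^ j * (1 - T (y n)) ^ (n - j))
      \<longlonglongrightarrow> exp (- u) ^ j / fact j * exp (- exp (- u))" for j
    by (rule tendsto_binomial_poisson[where p = "\<lambda>n. T (y n)"])
  then have "(\<lambda>n. \<Sum>j<k. real (n choose j) * T (y n) ^ j * (1 - T (y n)) ^ (n - j))
      \<longlonglongrightarrow> (\<Sum>j<k. exp (- u) ^ j / fact j * exp (- exp (- u)))"
    by (rule tendsto_sum)
  also have "(\<Sum>j<k. exp (- u) ^ j / fact j * exp (- exp (- u)))
      = exp (- exp (- u)) * (\<Sum>j<k. exp (- real j * u) / fact j)"
  proof -
    have "exp (- real j * u) = exp (- u) ^ j" for j
      using exp_of_nat_mult[of j "- u"] by simp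
    then show ?thesis by (simp only: sum_distrib_left mult_ac times_divide_eq_right)
  qed
  finally show ?thesis
  proof (rule Lim_transform_eventually)
    show "\<forall>\<^sub>F n in sequentially. (\<Sum>j<k. real (n choose j) * T (y n) ^ j * (1 - T (y n)) ^ (n - j))
        = prob {\<omega> \<in> space M. (kth_largest k n (\<lambda>i. X i \<omega>) - \<eta> n) / \<xi> n \<le> u}"
      using order_tendstoD(1)[OF \<xi>_lim \<kappa>] y0 eventually_ge_at_top[of k]
    proof eventually_elim
      case (elim n)
      have "{\<omega> \<in> space M. (kth_largest k n (\<lambda>i. X i \<omega>) - \<eta> n) / \<xi> n \<le> u}
          = {\<omega> \<in> space M. kth_largest k n (\<lambda>i. X i \<omega>) \<le> y n}"
        \<comment> \<open>Clearing the denominator uses \<open>\<xi> n > 0\<close>, which holds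
          eventually because the limit \<kappa> is positive.\<close>
        using elim(1) by (auto simp: y_def field_simps)
      also have "\<dots> = {\<omega> \<in> space M. card {i \<in> {1..n}. X i \<omega> \<in> {y n<..}} < k}"
        by (simp add: kth_largest_le_iff[OF k elim(3)])
      also have "prob \<dots> = (\<Sum>j<k. real (card {1..n} choose j) * T (y n) ^ j * (1 - T (y n)) ^ (card {1..n} - j))"
      proof (rule prob_card_less_indep)
        show "indep_vars (\<lambda>_. borel) X {1..n}"
          by (rule indep_vars_subset[OF indep]) auto
        show "prob {\<omega> \<in> space M. X i \<omega> \<in> {y n<..}} = T (y n)" if "i \<in> {1..n}" for i
          using tail[of i "y n"] that elim(2) by simp
      qed (use k elim(3) in auto)
      finally show ?case by simp
    qed
  qed
qed

section \<open>Application to SNR-based selection\<close>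

theorem proposition1:
  fixes \<Omega> :: "'a measure"
    and g h :: "nat \<Rightarrow> 'a \<Rightarrow> complex"
    and P\<^sub>t \<sigma>\<^sub>n t\<^sub>1 t\<^sub>2 a b c :: real
    and E X :: "nat \<Rightarrow> 'a \<Rightarrow> real"
    and F :: "real \<Rightarrow> real"
    and \<eta> \<xi> :: "nat \<Rightarrow> real"
    and k :: nat
    and u :: real
  assumes prob_space: "prob_space \<Omega>"
    and params: "P\<^sub>t > 0" "\<sigma>\<^sub>n\<^sup>2 > 0" "0 < t\<^sub>1" "t\<^sub>1 < 1" "t\<^sub>2 = 1 - t\<^sub>1" "c > 0" "a * c - b > 0"
    and g_distr: "\<And>i. i \<ge> 1 \<Longrightarrow>
      distributed \<Omega> lborel (\<lambda>\<omega>. (cmod (g i \<omega>))\<^sup>2) (exponential_density 1)"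
    and h_distr: "\<And>i. i \<ge> 1 \<Longrightarrow>
      distributed \<Omega> lborel (\<lambda>\<omega>. (cmod (h i \<omega>))\<^sup>2) (exponential_density 1)"
    and indep: "prob_space.indep_vars \<Omega> (\<lambda>_. borel)
      (case_sum (\<lambda>i \<omega>. (cmod (g i \<omega>))\<^sup>2) (\<lambda>i \<omega>. (cmod (h i \<omega>))\<^sup>2)) ({1..} <+> {1..})"
    and E: "\<And>i \<omega>. E i \<omega> =
      t\<^sub>1 * ((a * P\<^sub>t * (cmod (g i \<omega>))\<^sup>2 + b) / (P\<^sub>t * (cmod (g i \<omega>))\<^sup>2 + c) - b / c)"
    and X: "\<And>i \<omega>. X i \<omega> = (cmod (h i \<omega>))\<^sup>2 / (t\<^sub>2 * \<sigma>\<^sub>n\<^sup>2) * E i \<omega>"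
    and F: "F = cdf (distr \<Omega> borel (X 1))"
    and \<eta>: "\<And>M. \<eta> M = inv_into {0..} F (1 - 1 / real M)"
    and \<xi>: "\<And>M. \<xi> M = inv_into {0..} F (1 - 1 / (exp 1 * real M)) - \<eta> M"
    and k: "k \<ge> 1"
  shows "(\<lambda>M. measure \<Omega> {\<omega> \<in> space \<Omega>. (kth_largest k M (\<lambda>i. X i \<omega>) - \<eta> M) / \<xi> M \<le> u})
    \<longlonglongrightarrow> exp (- exp (- u)) * (\<Sum>j<k. exp (- real j * u) / fact j)"
proof -
  interpret prob_space \<Omega> by (rule prob_space)
  define G where "G i \<omega> = (cmod (g i \<omega>))\<^sup>2" for i \<omega>
  define H where "H i \<omega> = (cmod (h i \<omega>))\<^sup>2" for i \<omega>
  define Z where "Z = case_sum G H"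
  define \<gamma> where "\<gamma> = c / P\<^sub>t"
  define \<kappa> where "\<kappa> = t\<^sub>1 * (a * c - b) / (c * (t\<^sub>2 * \<sigma>\<^sub>n\<^sup>2))"
  have \<gamma>: "0 < \<gamma>" using params by (simp add: \<gamma>_def)
  have \<kappa>: "0 < \<kappa>" unfolding \<kappa>_def using params by (intro divide_pos_pos mult_pos_pos) auto
  have indep_Z: "indep_vars (\<lambda>_. borel) Z ({1..} <+> {1..})"
    using indep by (simp add: Z_def G_def[abs_def] H_def[abs_def])
  have GH: "distributed \<Omega> lborel (G i) (exponential_density 1)"
    "distributed \<Omega> lborel (H i) (exponential_density 1)" if "1 \<le> i" for i
    using g_distr[OF that] h_distr[OF that] by (simp_all add: G_def[abs_def] H_def[abs_def])
  have X_eq: "X i \<omega> = \<kappa> * H i \<omega> * G i \<omega> / (G i \<omega> + \<gamma>)" for i \<omega>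
  proof -
    have "0 < P\<^sub>t * G i \<omega> + c"
      using params by (simp add: G_def add_nonneg_pos)
    then have "(a * P\<^sub>t * G i \<omega> + b) / (P\<^sub>t * G i \<omega> + c) - b / c
        = (a * c - b) / c * (P\<^sub>t * G i \<omega> / (P\<^sub>t * G i \<omega> + c))"
      using params(6) by (simp add: divide_simps) (simp add: algebra_simps)
    moreover have "G i \<omega> / (G i \<omega> + \<gamma>) = P\<^sub>t * G i \<omega> / (P\<^sub>t * G i \<omega> + c)"
    proof -
      have "G i \<omega> + \<gamma> = (P\<^sub>t * G i \<omega> + c) / P\<^sub>t"
        using params(1) by (simp add: \<gamma>_def add_divide_distrib)
      then show ?thesis by simp
    qed
    ultimately have "(a * P\<^sub>t * G i \<omega> + b) / (P\<^sub>t * G i \<omega> + c) - b / c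
        = (a * c - b) / c * (G i \<omega> / (G i \<omega> + \<gamma>))" by simp
    then show ?thesis
      by (simp add: X E \<kappa>_def G_def H_def mult_ac)
  qed
  have indep_X: "indep_vars (\<lambda>_. borel) X {1..}"
  proof -
    \<comment> \<open>The gains are grouped into disjoint blocks, one per device; \<open>X j\<close>
      is a measurable function of block \<open>j\<close>.\<close>
    have "indep_vars (\<lambda>j. PiM {Inl j, Inr j} (\<lambda>_. borel))
        (\<lambda>j \<omega>. restrict (\<lambda>i. Z i \<omega>) {Inl j, Inr j}) {1..}"
      by (rule indep_vars_restrict[OF indep_Z]) (auto simp: disjoint_family_on_def)
    from indep_vars_compose2[OF this, of "\<lambda>j f. \<kappa> * f (Inr j) * f (Inl j) / (f (Inl j) + \<gamma>)" "\<lambda>_. borel"]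
    have "indep_vars (\<lambda>_. borel) (\<lambda>j \<omega>. \<kappa> * H j \<omega> * G j \<omega> / (G j \<omega> + \<gamma>)) {1..}"
      by (simp add: Z_def)
    then show ?thesis by (simp add: X_eq[abs_def])
  qed
  have rv_X: "random_variable borel (X i)" if "1 \<le> i" for i
    using indep_X that by (simp add: indep_vars_def2)
  have indep_GH: "indep_var borel (G i) borel (H i)" if "1 \<le> i" for i
  proof -
    have "indep_var (PiM {Inl i} (\<lambda>_. borel)) (\<lambda>\<omega>. restrict (\<lambda>i. Z i \<omega>) {Inl i})
        (PiM {Inr i} (\<lambda>_. borel)) (\<lambda>\<omega>. restrict (\<lambda>i. Z i \<omega>) {Inr i})"
      using that by (intro indep_var_restrict[OF indep_Z]) auto
    from indep_var_compose[OF this, of "\<lambda>f. f (Inl i)" borel "\<lambda>f. f (Inr i)" borel]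
    show ?thesis by (simp add: Z_def comp_def)
  qed
  have tail: "prob {\<omega> \<in> space \<Omega>. x < X i \<omega>} = snr_tail \<gamma> (x / \<kappa>)" if i: "1 \<le> i" and x: "0 \<le> x" for i x
  proof -
    have [measurable]: "random_variable borel (G i)" "random_variable borel (H i)"
      using GH[OF i] by (auto simp: distributed_def)
    note rv_X[OF i, measurable]
    have "prob {\<omega> \<in> space \<Omega>. 0 < G i \<omega>} = 1"
      using exponential_distributedD_gt[OF GH(1)[OF i], of 0] by simp
    \<comment> \<open>At \<open>G i \<omega> = 0\<close> the event would be rewritten wrongly:
      \<open>X i \<omega>\<close> is 0 there, while \<open>\<gamma> / G i \<omega>\<close> takes the
      default value 0 and leaves \<open>x / \<kappa> < H i \<omega>\<close>.\<close>
    then have "AE \<omega> in \<Omega>. 0 < G i \<omega>"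
      by (subst (asm) prob_Collect_eq_1) auto
    then have "prob {\<omega> \<in> space \<Omega>. x < X i \<omega>} = prob {\<omega> \<in> space \<Omega>. x / \<kappa> * (1 + \<gamma> / G i \<omega>) < H i \<omega>}"
    proof (intro finite_measure_eq_AE, eventually_elim)
      case (elim \<omega>)
      have "x < X i \<omega> \<longleftrightarrow> x * (G i \<omega> + \<gamma>) < H i \<omega> * (\<kappa> * G i \<omega>)"
        using elim \<gamma> by (simp add: X_eq pos_less_divide_eq mult_ac)
      also have "\<dots> \<longleftrightarrow> x * (G i \<omega> + \<gamma>) / (\<kappa> * G i \<omega>) < H i \<omega>"
        using elim \<kappa> by (simp add: pos_divide_less_eq)
      also have "x * (G i \<omega> + \<gamma>) / (\<kappa> * G i \<omega>) = x / \<kappa> * (1 + \<gamma> / G i \<omega>)"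
        using elim by (simp add: add_divide_distrib distrib_left)
      finally have "x < X i \<omega> \<longleftrightarrow> x / \<kappa> * (1 + \<gamma> / G i \<omega>) < H i \<omega>" .
      then show ?case by simp
    qed auto
    also have "\<dots> = snr_tail \<gamma> (x / \<kappa>)"
      using x \<kappa> by (intro prob_snr_tail GH indep_GH i \<gamma>) auto
    finally show ?thesis .
  qed

  interpret D: real_distribution "distr \<Omega> borel (X 1)"
    by (rule real_distribution_distr) (simp add: rv_X)
  define T where "T x = 1 - F x" for x
  have T: "antimono T"
    unfolding T_def F by (intro antimonoI diff_left_mono D.cdf_nondecreasing)
  have T_tail: "T x = snr_tail \<gamma> (x / \<kappa>)" if "0 \<le> x" for x
  proof -
    have "F x = prob {\<omega> \<in> space \<Omega>. X 1 \<omega> \<le> x}"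
      using rv_X[of 1] by (simp add: F cdf_def measure_distr vimage_def Int_def conj_commute)
    also have "\<dots> = 1 - prob {\<omega> \<in> space \<Omega>. x < X 1 \<omega>}"
      using rv_X[of 1] by (subst prob_neg[symmetric]) (auto simp: not_less)
    finally show ?thesis
      using tail[of 1 x] that by (simp add: T_def)
  qed
  have quantile: "T (inv_into {0..} F p) = 1 - p" if p: "0 \<le> p" "p < 1" for p
  proof -
    \<comment> \<open>The witness solves \<open>exp (- z / \<kappa>) = 1 - p\<close>, so the
      exponential bound on the tail gives \<open>F z \<ge> p\<close>.\<close>
    define z where "z = - \<kappa> * ln (1 - p)"
    have z: "0 \<le> z"
      using p \<kappa> by (simp add: z_def mult_le_0_iff)
    have "T z \<le> 1 - p"
      using snr_tail_le[of "z / \<kappa>" \<gamma>] z \<kappa> \<gamma> p by (simp add: T_tail) (simp add: z_def)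
    then have "p \<le> F z" by (simp add: T_def)
    moreover have "F 0 \<le> p"
      using T_tail[of 0] p by (simp add: snr_tail_0 T_def)
    moreover have "continuous_on {0..z} F"
    proof (rule continuous_on_eq)
      show "continuous_on {0..z} (\<lambda>x. 1 - snr_tail \<gamma> (x / \<kappa>))"
        using \<kappa> by (intro continuous_intros continuous_on_compose2[OF continuous_on_snr_tail[OF \<gamma>]]) auto
      show "1 - snr_tail \<gamma> (x / \<kappa>) = F x" if "x \<in> {0..z}" for x
        using T_tail[of x] that by (simp add: T_def)
    qed
    ultimately obtain x where "0 \<le> x" "F x = p"
      using IVT'[of F 0 p z] z by auto
    \<comment> \<open>Only for \<open>p\<close> in the image does \<open>inv_into\<close> return a
      genuine preimage.\<close>
    then have "p \<in> F ` {0..}" by auto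
    then show ?thesis by (simp add: T_def f_inv_into_f)
  qed
  show ?thesis
  proof (rule kth_largest_gumbel[OF indep_X _ T _ \<kappa>])
    show "prob {\<omega> \<in> space \<Omega>. y < X i \<omega>} = T y" if "1 \<le> i" "0 \<le> y" for i y
      using that by (simp add: tail T_tail)
    show "0 < T y" for y
    proof -
      \<comment> \<open>The formula for \<open>T\<close> is available at nonnegative arguments only;
        monotonicity covers the negative ones.\<close>
      have "0 < T (max y 0)"
        using \<gamma> \<kappa> by (simp add: T_tail snr_tail_pos)
      also have "\<dots> \<le> T y"
        by (rule antimonoD[OF T]) simp
      finally show ?thesis .
    qed
    show "((\<lambda>x. T (x + \<kappa> * v) / T x) \<longlongrightarrow> exp (- v)) at_top" for v
    proof (rule Lim_transform_eventually)
      have "filterlim (\<lambda>x. x * (1 / \<kappa>)) at_top at_top"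
        using \<kappa> by (intro filterlim_at_top_mult_tendsto_pos[OF tendsto_const] filterlim_ident) auto
      then have "filterlim (\<lambda>x. x / \<kappa>) at_top at_top" by simp
      then show "((\<lambda>x. snr_tail \<gamma> (x / \<kappa> + v) / snr_tail \<gamma> (x / \<kappa>)) \<longlongrightarrow> exp (- v)) at_top"
        by (rule filterlim_compose[OF snr_tail_ratio_tendsto[OF \<gamma>]])
      show "\<forall>\<^sub>F x in at_top. snr_tail \<gamma> (x / \<kappa> + v) / snr_tail \<gamma> (x / \<kappa>) = T (x + \<kappa> * v) / T x"
        \<comment> \<open>Both \<open>x\<close> and \<open>x + \<kappa> * v\<close> must be
          nonnegative for the tail formula to apply.\<close>
        using eventually_ge_at_top[of "0 :: real"] eventually_ge_at_top[of "- \<kappa> * v"]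
      proof eventually_elim
        case (elim x)
        have "(x + \<kappa> * v) / \<kappa> = x / \<kappa> + v"
          using \<kappa> by (simp add: field_simps)
        with elim show ?case by (simp add: T_tail)
      qed
    qed
    show "\<forall>\<^sub>F n in sequentially. T (\<eta> n) = 1 / real n"
      \<comment> \<open>At \<open>n = 0\<close> the level \<open>1 - 1 / 0\<close> would be 1,
        outside the range of \<open>quantile\<close>.\<close>
      using eventually_gt_at_top[of 0] by eventually_elim (simp add: \<eta> quantile)
    show "\<forall>\<^sub>F n in sequentially. T (\<eta> n + \<xi> n) = 1 / (exp 1 * real n)"
      using eventually_gt_at_top[of 0]
    proof eventually_elim
      case (elim n)
      have "1 * 1 \<le> exp 1 * real n"
        using elim by (intro mult_mono) auto
      then show ?case by (simp add: \<xi> quantile)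
    qed
  qed (rule k)
qed

end
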